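(* Let $\alpha,\beta,\gamma>0$ be fixed, $n\in\mathbb N$, and for $c\in(0,1)$ let $x_k=x_k(c)$, $k\ge0$, be the quantities attached to the hypergeometric weights $w_k=\frac{(\alpha)_k(\beta)_k}{(\gamma)_k\,k!}c^k$ as defined in the context. Put $S_n=\sum_{k=0}^{n-1}x_k$ and $\sigma_n=(c-1)S_n+Kc+L$, with $$K=\alpha\beta-\tfrac14(\alpha+\beta+n)^2,$$ $$L=\tfrac14\big((\alpha+\beta+\gamma+1)n+\alpha^2+\beta^2-(\alpha+\beta)(\gamma+1)+2\gamma\big).$$ Then $\sigma_n$, as a function of $c\in(0,1)$ (with $'=\frac{d}{dc}$), satisfies the Painlevé VI $\sigma$-equation $$\sigma_n'\big[c(c-1)\sigma_n''\big]^2+\big[\sigma_n'\big(2\sigma_n-(2c-1)\sigma_n'\big)+d_1d_2d_3d_4\big]^2=(\sigma_n'+d_1^2)(\sigma_n'+d_2^2)(\sigma_n'+d_3^2)(\sigma_n'+d_4^2),$$ with parameters $$d_1=\frac{n+\alpha-\beta}{2},\quad d_2=\frac{-n+\alpha-\beta}{2},\quad d_3=\frac{n+\alpha+\beta-2}{2},\quad d_4=\frac{n+\alpha+\beta-2\gamma}{2}.$$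
   Context: Here $(a)_k=a(a+1)\cdots(a+k-1)$ is the Pochhammer symbol. Let $\alpha,\beta,\gamma>0$, $0<c<1$, and $w_k=\frac{(\alpha)_k(\beta)_k}{(\gamma)_k\,k!}c^k$ for $k\in\mathbb N=\{0,1,2,\dots\}$. Let $(p_n)_{n\ge0}$ be the orthonormal polynomials, $p_n$ of degree $n$ with positive leading coefficient, $\sum_{k=0}^\infty p_n(k)p_m(k)w_k=\delta_{m,n}$. They satisfy a three-term recurrence $xp_n(x)=a_{n+1}p_{n+1}(x)+b_np_n(x)+a_np_{n-1}(x)$ with $a_0=0$, $a_n>0$ for $n\ge1$ (and $p_{-1}=0$). The discrete potential is $$u(x)=-1+\frac{(\gamma+x-1)x}{c(\alpha+x-1)(\beta+x-1)},$$ with the convention $u(0)=-1$. Define, as a rational function of $x$, $$\frac{A_n(x)}{a_n}:=\sum_{k=0}^\infty p_n(k)p_n(k-1)\frac{u(x+1)-u(k)}{x+1-k}\,w_k$$ (this formula is the definition of the symbol $A_n/a_n$ also for $n=0$). The sequence $x_n$ is determined by $$\frac{A_n(x)}{a_n}=\frac{1-c}{c}\,\frac{x+x_n}{(x+\alpha)(x+\beta)}.$$ When $\alpha\neq\beta$ and $\frac{A_n(x)}{a_n}=\frac{u_n}{x+\alpha}+\frac{v_n}{x+\beta}$, this means $x_n=\frac{c}{1-c}(\beta u_n+\alpha v_n)$. All these quantities are functions of the parameter $c\in(0,1)$, for fixed $\alpha,\beta,\gamma$. *)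

theory Defs
  imports "HOL-Analysis.Analysis" "HOL-Computational_Algebra.Polynomial"
begin

definition hyp_weight :: "real \<Rightarrow> real \<Rightarrow> real \<Rightarrow> real \<Rightarrow> nat \<Rightarrow> real" where
  "hyp_weight \<alpha> \<beta> \<gamma> c k =
     pochhammer \<alpha> k * pochhammer \<beta> k / (pochhammer \<gamma> k * fact k) * c ^ k"

definition orthonormal_polys :: "(nat \<Rightarrow> real) \<Rightarrow> (nat \<Rightarrow> real poly) \<Rightarrow> bool" where
  "orthonormal_polys w P \<longleftrightarrow>
     (\<forall>n. degree (P n) = n \<and> lead_coeff (P n) > 0) \<and>
     (\<forall>m n. (\<lambda>k. poly (P n) (real k) * poly (P m) (real k) * w k) sums (if m = n then 1 else 0))"

text \<open>The value at 0 is set separately: for \<open>\<alpha> = 1\<close> or \<open>\<beta> = 1\<close> the rational expression is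
  singular or has a removable singularity there.\<close>

definition potential :: "real \<Rightarrow> real \<Rightarrow> real \<Rightarrow> real \<Rightarrow> real \<Rightarrow> real" where
  "potential \<alpha> \<beta> \<gamma> c x =
     (if x = 0 then -1
      else -1 + (\<gamma> + x - 1) * x / (c * (\<alpha> + x - 1) * (\<beta> + x - 1)))"

text \<open>The rational function \<open>A\<^sub>n / a\<^sub>n\<close>. The series gives its value at every real \<open>x\<close> which is
  neither a pole (\<open>-\<alpha>\<close> or \<open>-\<beta>\<close>) nor a node \<open>k - 1\<close>; at the nodes one of the difference
  quotients is \<open>0/0\<close>, that is, \<open>0\<close> in HOL.\<close>

definition A_ratio ::
  "real \<Rightarrow> real \<Rightarrow> real \<Rightarrow> real \<Rightarrow> (nat \<Rightarrow> real poly) \<Rightarrow> nat \<Rightarrow> real \<Rightarrow> real" where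
  "A_ratio \<alpha> \<beta> \<gamma> c P n x =
     (\<Sum>k. poly (P n) (real k) * poly (P n) (real k - 1)
          * ((potential \<alpha> \<beta> \<gamma> c (x + 1) - potential \<alpha> \<beta> \<gamma> c (real k)) / (x + 1 - real k))
          * hyp_weight \<alpha> \<beta> \<gamma> c k)"

text \<open>An identity of rational functions in \<open>x\<close>, hence required only off the poles and nodes.\<close>

definition x_coeff :: "real \<Rightarrow> real \<Rightarrow> real \<Rightarrow> real \<Rightarrow> (nat \<Rightarrow> real poly) \<Rightarrow> nat \<Rightarrow> real" where
  "x_coeff \<alpha> \<beta> \<gamma> c P n =
     (THE \<xi>. \<forall>x. x \<noteq> - \<alpha> \<and> x \<noteq> - \<beta> \<and> x + 1 \<notin> \<nat> \<longrightarrow>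
        A_ratio \<alpha> \<beta> \<gamma> c P n x = (1 - c) / c * ((x + \<xi>) / ((x + \<alpha>) * (x + \<beta>))))"

definition S_sum ::
  "real \<Rightarrow> real \<Rightarrow> real \<Rightarrow> (real \<Rightarrow> nat \<Rightarrow> real poly) \<Rightarrow> nat \<Rightarrow> real \<Rightarrow> real" where
  "S_sum \<alpha> \<beta> \<gamma> p n c = (\<Sum>k<n. x_coeff \<alpha> \<beta> \<gamma> c (p c) k)"

definition K_const :: "real \<Rightarrow> real \<Rightarrow> nat \<Rightarrow> real" where
  "K_const \<alpha> \<beta> n = \<alpha> * \<beta> - 1 / 4 * (\<alpha> + \<beta> + real n)\<^sup>2"

definition L_const :: "real \<Rightarrow> real \<Rightarrow> real \<Rightarrow> nat \<Rightarrow> real" where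
  "L_const \<alpha> \<beta> \<gamma> n =
     1 / 4 * ((\<alpha> + \<beta> + \<gamma> + 1) * real n + \<alpha>\<^sup>2 + \<beta>\<^sup>2 - (\<alpha> + \<beta>) * (\<gamma> + 1) + 2 * \<gamma>)"

definition sigma_fun ::
  "real \<Rightarrow> real \<Rightarrow> real \<Rightarrow> (real \<Rightarrow> nat \<Rightarrow> real poly) \<Rightarrow> nat \<Rightarrow> real \<Rightarrow> real" where
  "sigma_fun \<alpha> \<beta> \<gamma> p n c = (c - 1) * S_sum \<alpha> \<beta> \<gamma> p n c + K_const \<alpha> \<beta> n * c + L_const \<alpha> \<beta> \<gamma> n"

text \<open>Differentiability is part of being a solution, as \<^const>\<open>deriv\<close> is unspecified without it.\<close>

definition sigma_PVI_at :: "real \<Rightarrow> real \<Rightarrow> real \<Rightarrow> real \<Rightarrow> (real \<Rightarrow> real) \<Rightarrow> real \<Rightarrow> bool" where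
  "sigma_PVI_at d1 d2 d3 d4 \<sigma> c \<longleftrightarrow>
     \<sigma> differentiable (at c) \<and> deriv \<sigma> differentiable (at c) \<and>
     deriv \<sigma> c * (c * (c - 1) * deriv (deriv \<sigma>) c)\<^sup>2
       + (deriv \<sigma> c * (2 * \<sigma> c - (2 * c - 1) * deriv \<sigma> c) + d1 * d2 * d3 * d4)\<^sup>2
     = (deriv \<sigma> c + d1\<^sup>2) * (deriv \<sigma> c + d2\<^sup>2) * (deriv \<sigma> c + d3\<^sup>2) * (deriv \<sigma> c + d4\<^sup>2)"

end

theory Submission
  imports Defs
begin

text \<open>
  Multiplied by \<open>(x + \<alpha>)(x + \<beta>)\<close>, the sums \<open>\<Sum>\<^sub>k p\<^sub>n(k) p\<^sub>m(k - 1) (u(x + 1) - u(k)) / (x + 1 - k) w\<^sub>k\<close>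
  become polynomials linear in \<open>x\<close>, expressible through \<open>f \<mapsto> \<Sum>\<^sub>k f(k) w\<^sub>k\<close> alone. Evaluating
  the factor \<open>x + 1 - k\<close> once by the Pearson equation and once by the three-term recurrence in
  either argument yields relations between the cases \<open>m = n\<close> and \<open>m = n - 1\<close>, \<open>n + 1\<close>, and these
  telescope to a quadratic identity in \<open>x\<close>. Its three coefficients give, for a fixed \<open>n\<close>, an
  algebraic relation between \<open>S\<^sub>n\<close>, \<open>a\<^sub>n\<^sup>2\<close> and \<open>x\<^sub>n - x\<^sub>n\<^sub>-\<^sub>1\<close>. By the Toda equations
  \<open>c d/dc (\<Sum>\<^sub>k\<^sub><\<^sub>n b\<^sub>k) = a\<^sub>n\<^sup>2\<close> and \<open>c d/dc a\<^sub>n\<^sup>2 = a\<^sub>n\<^sup>2 (b\<^sub>n - b\<^sub>n\<^sub>-\<^sub>1)\<close> these are,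
  up to elementary terms, \<open>\<sigma>\<^sub>n\<close>, \<open>\<sigma>\<^sub>n'\<close> and \<open>\<sigma>\<^sub>n''\<close>, and the relation is the \<open>\<sigma>\<close>-equation.
\<close>

section \<open>Orthogonal polynomials for a discrete weight\<close>

lemma poly_ext:
  fixes p q :: "real poly"
  assumes "\<And>y. poly p y = poly q y"
  shows "p = q"
  using assms by (simp add: poly_eq_poly_eq_iff[symmetric] fun_eq_iff)

definition wsum :: "(nat \<Rightarrow> real) \<Rightarrow> real poly \<Rightarrow> real" where
  "wsum w f = (\<Sum>k. poly f (real k) * w k)"

definition shift_poly :: "real \<Rightarrow> real poly \<Rightarrow> real poly" where
  "shift_poly a f = f \<circ>\<^sub>p [:a, 1:]"

lemma poly_shift_poly [simp]: "poly (shift_poly a f) x = poly f (x + a)"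
  by (simp add: shift_poly_def poly_pcompose add.commute)

lemma shift_poly_mult: "shift_poly a (f * g) = shift_poly a f * shift_poly a g"
  by (simp add: shift_poly_def pcompose_mult)

lemma shift_poly_linear:
  "shift_poly a (f + g) = shift_poly a f + shift_poly a g"
  "shift_poly a (f - g) = shift_poly a f - shift_poly a g"
  "shift_poly a (smult t f) = smult t (shift_poly a f)"
  by (simp_all add: shift_poly_def pcompose_add pcompose_diff pcompose_smult)

lemma degree_shift_poly [simp]: "degree (shift_poly a f) = degree f"
  by (simp add: shift_poly_def degree_pcompose)

lemma shift_poly_inverse: "shift_poly a (shift_poly (- a) f) = f"
  by (rule poly_ext) simp

text \<open>This is the start of the binomial expansion. Both coefficients are proved together
  because the second one of \<open>pCons b q\<close> uses both of \<open>q\<close>; the bound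
  \<open>\<le>\<close> on the degree lets the induction pass to \<open>q\<close>.\<close>

lemma coeff_shift_poly:
  assumes "degree f \<le> Suc n"
  shows "coeff (shift_poly a f) (Suc n) = coeff f (Suc n)"
    and "coeff (shift_poly a f) n = coeff f n + (real n + 1) * a * coeff f (Suc n)"
proof -
  have "degree f \<le> Suc n \<Longrightarrow> coeff (shift_poly a f) (Suc n) = coeff f (Suc n) \<and>
    coeff (shift_poly a f) n = coeff f n + (real n + 1) * a * coeff f (Suc n)"
  proof (induction n arbitrary: f)
    case 0
    have "f = [:coeff f 0, coeff f 1:]"
    proof (rule poly_eqI)
      fix i show "coeff f i = coeff [:coeff f 0, coeff f 1:] i"
        using 0 by (auto simp: coeff_pCons split: nat.splits intro: coeff_eq_0)
    qed
    then obtain b d where "f = [:b, d:]" by blast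
    then show ?case by (simp add: shift_poly_def pcompose_pCons)
  next
    case (Suc n)
    obtain b q where f: "f = pCons b q" by (cases f)
    have q: "degree q \<le> Suc n" using Suc.prems f by (cases "q = 0") auto
    have s: "shift_poly a (pCons b q) = [:b:] + smult a (shift_poly a q) + pCons 0 (shift_poly a q)"
      by (simp add: shift_poly_def pcompose_pCons)
    have z: "coeff (shift_poly a q) (Suc (Suc n)) = 0"  "coeff q (Suc (Suc n)) = 0"
      using q by (auto intro!: coeff_eq_0)
    show ?case using Suc.IH[OF q] z
      by (simp add: s f algebra_simps)
  qed
  then show "coeff (shift_poly a f) (Suc n) = coeff f (Suc n)"
    and "coeff (shift_poly a f) n = coeff f n + (real n + 1) * a * coeff f (Suc n)"
    using assms by blast+
qed

definition var_poly :: "real poly" where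
  "var_poly = [:0, 1:]"

lemma degree_var_poly [simp]: "degree var_poly = 1"
  by (simp add: var_poly_def)

lemma poly_var_poly [simp]: "poly var_poly x = x"
  by (simp add: var_poly_def)

lemma coeff_var_poly_mult: "coeff (var_poly * f) (Suc n) = coeff f n"
  by (simp add: var_poly_def)

section \<open>Monic orthogonal polynomials of a weight on the naturals\<close>

locale monic_ops =
  fixes w :: "nat \<Rightarrow> real" and P :: "nat \<Rightarrow> real poly" and h :: "nat \<Rightarrow> real"
  assumes summ: "\<And>f. summable (\<lambda>k. poly f (real k) * w k)"
    and deg [simp]: "\<And>n. degree (P n) = n"
    and monic: "\<And>n. coeff (P n) n = 1"
    and orth: "\<And>m n. wsum w (P m * P n) = (if m = n then h n else 0)"
    and h_pos: "\<And>n. h n > 0"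
begin

abbreviation L where "L \<equiv> wsum w"

lemma L_add: "L (f + g) = L f + L g"
  using suminf_add[OF summ summ, of f g] by (simp add: wsum_def algebra_simps)

lemma L_smult: "L (smult a f) = a * L f"
  using suminf_mult[OF summ, of a f] by (simp add: wsum_def algebra_simps)

lemma L_0 [simp]: "L 0 = 0"
  by (simp add: wsum_def)

lemma L_minus: "L (- f) = - L f"
  using L_smult[of "-1" f] by simp

lemma L_diff: "L (f - g) = L f - L g"
  using L_add[of f "- g"] by (simp add: L_minus)

text \<open>Subtracting a multiple of the \<open>P\<close> of the same degree lowers the degree of
  \<open>f\<close>. A zero remainder is treated apart, since its degree need not be smaller when
  \<open>f\<close> is constant.\<close>

lemma L_P_lower_degree: "degree f < n \<Longrightarrow> L (P n * f) = 0"
proof (induction "degree f" arbitrary: f rule: less_induct)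
  case less
  let ?m = "degree f"
  define g where "g = f - smult (lead_coeff f) (P ?m)"
  have c: "coeff g ?m = 0" by (simp add: g_def monic)
  have d: "degree g \<le> ?m" unfolding g_def by (intro degree_diff_le) (auto intro: order_trans[OF degree_smult_le])
  have "L (P n * g) = 0"
  proof (cases "g = 0")
    case False
    then have "degree g < ?m" using c d le_neq_implies_less leading_coeff_0_iff by metis
    then show ?thesis using less by simp
  qed simp
  moreover have "f = g + smult (lead_coeff f) (P ?m)" by (simp add: g_def)
  then have "L (P n * f) = L (P n * g) + lead_coeff f * L (P n * P ?m)"
    by (metis L_add L_smult distrib_left mult_smult_right)
  ultimately show ?case using orth[of n ?m] less.prems by simp
qed

lemma L_P_mult: "degree f \<le> n \<Longrightarrow> L (P n * f) = coeff f n * h n"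
proof -
  assume a: "degree f \<le> n"
  define g where "g = f - smult (coeff f n) (P n)"
  have c: "coeff g n = 0" by (simp add: g_def monic)
  have d: "degree g \<le> n" unfolding g_def by (intro degree_diff_le a) (auto intro: order_trans[OF degree_smult_le])
  have "L (P n * g) = 0"
  proof (cases "g = 0")
    case False
    then have "degree g < n" using c d le_neq_implies_less leading_coeff_0_iff by metis
    then show ?thesis by (rule L_P_lower_degree)
  qed simp
  moreover have "f = g + smult (coeff f n) (P n)" by (simp add: g_def)
  then have "L (P n * f) = L (P n * g) + coeff f n * L (P n * P n)"
    by (metis L_add L_smult distrib_left mult_smult_right)
  ultimately show ?thesis using orth[of n n] by simp
qed

text \<open>A nonzero \<open>f\<close> tested against \<open>P (degree f)\<close> would give
  \<open>lead_coeff f * h (degree f)\<close>, which is nonzero.\<close>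

lemma poly_eq_0_if_orth:
  assumes "degree f \<le> n" "\<And>j. j \<le> n \<Longrightarrow> L (P j * f) = 0"
  shows "f = 0"
proof (rule ccontr)
  assume "f \<noteq> 0"
  then show False
    using L_P_mult[of f "degree f"] h_pos[of "degree f"] assms by auto
qed

text \<open>The recurrence coefficients \<open>b\<^sub>n\<close> and \<open>a\<^sub>n\<^sup>2\<close>; \<open>r 0 = 0\<close> makes the junk index
  \<open>0 - 1\<close> in \<open>three_term\<close> harmless.\<close>

definition b :: "nat \<Rightarrow> real" where "b n = L (P n * (var_poly * P n)) / h n"
definition r :: "nat \<Rightarrow> real" where "r n = (if n = 0 then 0 else h n / h (n - 1))"

text \<open>The difference of the two sides has degree at most \<open>Suc n\<close> and is
  orthogonal to each \<open>P j\<close> with \<open>j \<le> Suc n\<close>. For \<open>j < n\<close>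
  the factor \<open>var_poly\<close> is moved from \<open>P n\<close> to \<open>P j\<close>, so that
  only the degree of \<open>var_poly * P j\<close> matters.\<close>

lemma three_term: "var_poly * P n = P (Suc n) + smult (b n) (P n) + smult (r n) (P (n - 1))"
proof -
  define f where "f = var_poly * P n - P (Suc n) - smult (b n) (P n) - smult (r n) (P (n - 1))"
  have d: "degree f \<le> Suc n" unfolding f_def
    by (intro degree_diff_le order_trans[OF degree_smult_le] order_trans[OF degree_mult_le]) auto
  have hn: "h j \<noteq> 0" for j using h_pos[of j] by simp
  have "L (P j * f) = 0" if j: "j \<le> Suc n" for j
  proof -
    have e: "L (P j * f) = L (P j * (var_poly * P n)) - L (P j * P (Suc n)) - b n * L (P j * P n)
       - r n * L (P j * P (n - 1))"
      unfolding f_def right_diff_distrib L_diff mult_smult_right L_smult ..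
    consider "j = Suc n" | "j = n" | "Suc j = n" | "Suc j < n" using j by linarith
    then show ?thesis
    proof cases
      case 1
      have "L (P j * (var_poly * P n)) = coeff (var_poly * P n) j * h j"
        using 1 by (intro L_P_mult order_trans[OF degree_mult_le]) auto
      then show ?thesis unfolding e using 1 by (auto simp: orth monic coeff_var_poly_mult)
    next
      case 2
      then show ?thesis unfolding e using hn by (auto simp: orth b_def r_def)
    next
      case 3
      have "L (P j * (var_poly * P n)) = L (P n * (var_poly * P j))" by (simp add: mult_ac)
      also have "\<dots> = coeff (var_poly * P j) n * h n"
        using 3 by (intro L_P_mult order_trans[OF degree_mult_le]) auto
      finally show ?thesis using 3 hn[of j] monic[of j]
        by (auto simp: e orth r_def coeff_var_poly_mult)
    next
      case 4
      have "L (P j * (var_poly * P n)) = L (P n * (var_poly * P j))" by (simp add: mult_ac)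
      also have "\<dots> = 0"
        using 4 by (intro L_P_lower_degree le_less_trans[OF degree_mult_le]) auto
      finally show ?thesis using 4
        by (auto simp: e orth)
    qed
  qed
  then have "f = 0" using poly_eq_0_if_orth[OF d] by blast
  then show ?thesis by (simp add: f_def algebra_simps)
qed

text \<open>A shift fixes the leading coefficient and adds \<open>(n + 1) * a\<close> to the next
  one of \<open>P (Suc n)\<close>; orthogonality sees nothing else. These values become the
  right-hand sides of the ladder relations and the slopes in \<open>x\<close>.\<close>

lemma L_P_shift:
  "L (P n * shift_poly a (P n)) = h n"
  "L (P (Suc n) * shift_poly a (P n)) = 0"
  "L (P n * shift_poly a (P (Suc n))) = (real n + 1) * a * h n"
proof -
  show "L (P n * shift_poly a (P n)) = h n"
  proof (cases n)
    case 0
    then have "coeff (shift_poly a (P n)) n = 1"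
      using coeff_shift_poly(2)[of "P 0" 0 a] monic[of 0] by (simp add: coeff_eq_0)
    then show ?thesis by (simp add: L_P_mult)
  next
    case (Suc m)
    then have "coeff (shift_poly a (P n)) n = 1"
      using coeff_shift_poly(1)[of "P n" m a] monic[of n] by simp
    then show ?thesis by (simp add: L_P_mult)
  qed
  show "L (P (Suc n) * shift_poly a (P n)) = 0"
    by (rule L_P_lower_degree) simp
  define f where "f = shift_poly a (P (Suc n)) - P (Suc n)"
  have "degree f \<le> n"
  proof (rule degree_le, intro allI impI)
    fix i assume "n < i"
    then consider "i = Suc n" | "Suc n < i" by linarith
    then show "coeff f i = 0"
      by cases (auto simp: f_def coeff_shift_poly intro!: coeff_eq_0 degree_diff_less)
  qed
  then have "L (P n * f) = coeff f n * h n" by (rule L_P_mult)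
  then show "L (P n * shift_poly a (P (Suc n))) = (real n + 1) * a * h n"
    by (simp add: f_def right_diff_distrib L_diff orth coeff_shift_poly monic)
qed

lemma L_sum: "L (\<Sum>i\<in>A. F i) = (\<Sum>i\<in>A. L (F i))"
  by (induction A rule: infinite_finite_induct) (simp_all add: L_add)

lemma L_mult_expand:
  assumes "degree f \<le> N"
  shows "L (q * f) = (\<Sum>i\<le>N. coeff f i * L (q * monom 1 i))"
proof -
  have "L (q * f) = L (q * (\<Sum>i\<le>N. smult (coeff f i) (monom 1 i)))"
    using poly_as_sum_of_monoms'[OF assms] by (simp add: smult_monom)
  then show ?thesis by (simp add: sum_distrib_left L_sum L_smult)
qed

text \<open>\<open>B n\<close> is the sum of the \<open>b k\<close> with \<open>k < n\<close>, by \<open>b_eq_B\<close> below.\<close>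

definition B :: "nat \<Rightarrow> real" where "B n = (if n = 0 then 0 else - coeff (P n) (n - 1))"

text \<open>Modulo \<open>P (Suc n)\<close>, the monomial has degree at most \<open>n\<close> and
  its coefficient there is \<open>B (Suc n)\<close>. Thus \<open>B (Suc n)\<close> is determined by
  \<open>P n\<close> and moments alone.\<close>

lemma L_P_monom_Suc: "L (P n * monom 1 (Suc n)) = h n * B (Suc n)"
proof -
  define f where "f = monom 1 (Suc n) - P (Suc n)"
  have "degree f \<le> n"
  proof (rule degree_le, intro allI impI)
    fix i assume "n < i"
    then consider "i = Suc n" | "Suc n < i" by linarith
    then show "coeff f i = 0"
      by cases (auto simp: f_def monic coeff_eq_0)
  qed
  then have "L (P n * f) = coeff f n * h n" by (rule L_P_mult)
  then show ?thesis by (simp add: f_def right_diff_distrib L_diff orth B_def)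
qed

lemma b_eq_B: "b n = B (Suc n) - B n"
proof -
  have "coeff (var_poly * P n) n
    = coeff (P (Suc n) + smult (b n) (P n) + smult (r n) (P (n - 1))) n"
    by (simp only: three_term)
  also have "\<dots> = coeff (P (Suc n)) n + b n + r n * coeff (P (n - 1)) n"
    by (simp add: monic)
  finally have "coeff (var_poly * P n) n = coeff (P (Suc n)) n + b n + r n * coeff (P (n - 1)) n" .
  moreover have "coeff (var_poly * P n) n = - B n"
    by (cases n) (simp_all add: B_def coeff_var_poly_mult var_poly_def)
  moreover have "r n * coeff (P (n - 1)) n = 0"
    by (cases n) (auto simp: r_def coeff_eq_0)
  moreover have "B (Suc n) = - coeff (P (Suc n)) n" by (simp add: B_def)
  ultimately show ?thesis by linarith
qed

lemma h_eq: "h n = (\<Sum>i\<le>n. coeff (P n) i * L (monom 1 (i + n)))"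
proof -
  have "h n = L (monom 1 n * P n)"
    using L_P_mult[of "monom 1 n" n] by (simp add: degree_monom_eq mult.commute)
  then show ?thesis using L_mult_expand[of "P n" n "monom 1 n"] by (simp add: mult_monom add.commute)
qed

end

text \<open>Since \<open>p 0\<close> is a nonzero constant, the orthogonality series against
  \<open>p 0\<close> give summability for every \<open>p n\<close>, and these span all
  polynomials.\<close>

lemma orthonormal_polys_summable:
  assumes "orthonormal_polys w p"
  shows "summable (\<lambda>k. poly f (real k) * w k)"
proof -
  have deg: "degree (p n) = n" and lc: "lead_coeff (p n) > 0" for n
    using assms unfolding orthonormal_polys_def by blast+
  have sums: "summable (\<lambda>k. poly (p n) (real k) * poly (p m) (real k) * w k)" for m n
    using assms by (auto simp: orthonormal_polys_def intro: sums_summable)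
  obtain a where a: "p 0 = [:a:]" using deg[of 0] by (auto elim: degree_eq_zeroE)
  then have "a \<noteq> 0" using lc[of 0] by auto
  have p: "summable (\<lambda>k. poly (p n) (real k) * w k)" for n
    using summable_mult[OF sums[of n 0], of "1 / a"] a \<open>a \<noteq> 0\<close> by (simp add: mult_ac)
  show ?thesis
  proof (induction "degree f" arbitrary: f rule: less_induct)
    case less
    define m t where "m = degree f" and "t = lead_coeff f / lead_coeff (p m)"
    define q where "q = f - smult t (p m)"
    have q: "summable (\<lambda>k. poly q (real k) * w k)"
    proof (cases "q = 0")
      case False
      have "coeff q m = 0" using lc[of m] by (simp add: q_def t_def m_def deg)
      moreover have "degree q \<le> m" unfolding q_def
        by (intro degree_diff_le order_trans[OF degree_smult_le]) (auto simp: m_def deg)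
      ultimately have "degree q < m"
        using False le_neq_implies_less leading_coeff_0_iff by metis
      then show ?thesis using less m_def by simp
    qed simp
    have "(\<lambda>k. poly f (real k) * w k)
      = (\<lambda>k. poly q (real k) * w k + t * (poly (p m) (real k) * w k))"
      by (simp add: q_def algebra_simps)
    then show ?case using summable_add[OF q summable_mult[OF p[of m], of t]] by simp
  qed
qed

lemma monic_ops_of_orthonormal:
  assumes "orthonormal_polys w p"
  shows "monic_ops w (\<lambda>n. smult (1 / lead_coeff (p n)) (p n)) (\<lambda>n. 1 / (lead_coeff (p n))\<^sup>2)"
proof
  have deg: "degree (p n) = n" and lc: "lead_coeff (p n) > 0" for n
    using assms unfolding orthonormal_polys_def by blast+
  have lc': "lead_coeff (p n) \<noteq> 0" for n using lc[of n] by linarith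
  fix m n f
  show "summable (\<lambda>k. poly f (real k) * w k)"
    by (rule orthonormal_polys_summable[OF assms])
  show "degree (smult (1 / lead_coeff (p n)) (p n)) = n"
    using lc'[of n] deg[of n] by simp
  show "coeff (smult (1 / lead_coeff (p n)) (p n)) n = 1"
    using lc'[of n] deg[of n] by simp
  show "1 / (lead_coeff (p n))\<^sup>2 > 0"
    by (rule divide_pos_pos[OF zero_less_one zero_less_power[OF lc]])
  have "(\<lambda>k. poly (p m) (real k) * poly (p n) (real k) * w k) sums (if n = m then 1 else 0)"
    using assms unfolding orthonormal_polys_def by blast
  then have "(\<lambda>k. 1 / (lead_coeff (p m) * lead_coeff (p n)) *
    (poly (p m) (real k) * poly (p n) (real k) * w k)) sums
    (1 / (lead_coeff (p m) * lead_coeff (p n)) * (if n = m then 1 else 0))"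
    by (rule sums_mult)
  then show "wsum w (smult (1 / lead_coeff (p m)) (p m) * smult (1 / lead_coeff (p n)) (p n))
    = (if m = n then 1 / (lead_coeff (p n))\<^sup>2 else 0)"
    unfolding wsum_def by (auto simp: sums_iff power2_eq_square mult_ac)
qed

section \<open>The hypergeometric weight\<close>

lemma hyp_weight_0 [simp]: "hyp_weight \<alpha> \<beta> \<gamma> c 0 = 1"
  by (simp add: hyp_weight_def)

lemma hyp_weight_Suc:
  assumes "\<gamma> > 0"
  shows "(\<gamma> + real k) * (real k + 1) * hyp_weight \<alpha> \<beta> \<gamma> c (Suc k)
    = c * (\<alpha> + real k) * (\<beta> + real k) * hyp_weight \<alpha> \<beta> \<gamma> c k"
proof -
  have "pochhammer \<gamma> k > 0" "\<gamma> + real k > 0"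
    using assms by (auto intro: pochhammer_pos)
  moreover have "hyp_weight \<alpha> \<beta> \<gamma> c (Suc k) = hyp_weight \<alpha> \<beta> \<gamma> c k
      * (c * (\<alpha> + real k) * (\<beta> + real k) / ((\<gamma> + real k) * (real k + 1)))"
    by (simp add: hyp_weight_def pochhammer_Suc mult_ac add_ac)
  ultimately show ?thesis by (simp add: divide_simps) (simp add: mult_ac)
qed

locale hyp_ops = monic_ops "hyp_weight \<alpha> \<beta> \<gamma> c" P h
  for \<alpha> \<beta> \<gamma> c :: real and P :: "nat \<Rightarrow> real poly" and h :: "nat \<Rightarrow> real" +
  assumes pos: "\<alpha> > 0" "\<beta> > 0" "\<gamma> > 0" and c: "0 < c" "c < 1"
begin

text \<open>An index shift by one. No boundary term appears, because the polynomial
  \<open>[:0, \<gamma> - 1, 1:]\<close> vanishes at the node 0.\<close>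

lemma Pearson:
  "L ([:0, \<gamma> - 1, 1:] * f) = c * L ([:\<alpha> * \<beta>, \<alpha> + \<beta>, 1:] * shift_poly 1 f)"
proof -
  let ?w = "hyp_weight \<alpha> \<beta> \<gamma> c"
  let ?g = "\<lambda>k. poly ([:0, \<gamma> - 1, 1:] * f) (real k) * ?w k"
  have "?g (Suc k) = c * (poly ([:\<alpha> * \<beta>, \<alpha> + \<beta>, 1:] * shift_poly 1 f) (real k) * ?w k)" for k
  proof -
    have "?g (Suc k) = poly f (real k + 1) * ((\<gamma> + real k) * (real k + 1) * ?w (Suc k))"
      by (simp add: algebra_simps)
    then show ?thesis unfolding hyp_weight_Suc[OF pos(3)] by (simp add: algebra_simps)
  qed
  moreover have "suminf ?g = (\<Sum>k. ?g (Suc k))"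
    using suminf_split_head[OF summ[of "[:0, \<gamma> - 1, 1:] * f"]] by simp
  ultimately have "suminf ?g = (\<Sum>k. c * (poly ([:\<alpha> * \<beta>, \<alpha> + \<beta>, 1:] * shift_poly 1 f) (real k) * ?w k))"
    by simp
  then show ?thesis unfolding wsum_def by (simp only: suminf_mult[OF summ])
qed

text \<open>The quotient of \<open>\<phi> x\<close> by \<open>\<psi> x\<close> is u(x + 1) +
  1.\<close>

definition \<psi> where "\<psi> x = (x + \<alpha>) * (x + \<beta>)"
definition \<phi> where "\<phi> x = (x + \<gamma>) * (x + 1) / c"

text \<open>\<open>\<psi> x\<close> times \<open>\<Sum>\<^sub>k f(k) (u(x + 1) - u(k)) / (x + 1 - k) w\<^sub>k\<close>, with \<open>u(k) w\<^sub>k = w\<^sub>k\<^sub>-\<^sub>1 - w\<^sub>k\<close>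
  used to remove the division; see \<open>A_ratio_eq\<close>.\<close>

definition G :: "real \<Rightarrow> real poly \<Rightarrow> real" where
  "G x f = L ([:x + \<gamma>, 1:] * f) / c - L ([:x + \<alpha> + \<beta>, 1:] * shift_poly 1 f)"

lemma G_diff: "G x (f - g) = G x f - G x g"
  by (simp add: G_def shift_poly_linear right_diff_distrib L_diff diff_divide_distrib del: mult_pCons_left)

lemma G_smult: "G x (smult t f) = t * G x f"
  by (simp add: G_def shift_poly_linear L_smult right_diff_distrib del: mult_pCons_left)

text \<open>Multiplied by the node factor, each linear factor in \<open>G\<close> splits into a
  function of \<open>x\<close> minus one of the two Pearson polynomials; by \<open>Pearson\<close>
  the latter contributions cancel.\<close>

lemma G_mult_node:
  "G x ([:x + 1, -1:] * f) = \<phi> x * L f - \<psi> x * L (shift_poly 1 f)"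
proof -
  have 1: "[:x + \<gamma>, 1:] * ([:x + 1, -1:] * f)
    = smult ((x + \<gamma>) * (x + 1)) f - [:0, \<gamma> - 1, 1:] * f"
    by (rule poly_ext) (simp add: algebra_simps)
  have 2: "[:x + \<alpha> + \<beta>, 1:] * shift_poly 1 ([:x + 1, -1:] * f)
    = smult (\<psi> x) (shift_poly 1 f) - [:\<alpha> * \<beta>, \<alpha> + \<beta>, 1:] * shift_poly 1 f"
    by (rule poly_ext) (simp add: \<psi>_def algebra_simps)
  show ?thesis
    unfolding G_def 1 2 L_diff L_smult Pearson using c(1)
    by (simp add: \<phi>_def field_simps del: mult_pCons_left)
qed

section \<open>Ladder and compatibility relations\<close>

definition M where "M x m n = G x (P m * shift_poly (- 1) (P n))"

text \<open>At a node y the factor x + 1 - y is read as (x + 1) - y for the recurrence of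
  \<open>P m\<close> at y, and as x - (y - 1) for that of \<open>P n\<close> at y - 1.\<close>

lemma M_three_term:
  shows "(x + 1 - b m) * M x m n - M x (Suc m) n - r m * M x (m - 1) n
    = \<phi> x * L (P m * shift_poly (- 1) (P n)) - \<psi> x * L (shift_poly 1 (P m) * P n)" (is "?A = ?R")
    and "(x - b n) * M x m n - M x m (Suc n) - r n * M x m (n - 1)
    = \<phi> x * L (P m * shift_poly (- 1) (P n)) - \<psi> x * L (shift_poly 1 (P m) * P n)" (is "?B = ?R")
proof -
  let ?S = "shift_poly (- 1)"
  have R: "G x ([:x + 1, -1:] * (P m * ?S (P n))) = ?R"
    unfolding G_mult_node shift_poly_mult shift_poly_inverse[of 1] ..
  have t: "y * poly (P n) y = poly (P (Suc n)) y + b n * poly (P n) y + r n * poly (P (n - 1)) y" for n y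
    using arg_cong[OF three_term[of n], of "\<lambda>p. poly p y"] by simp
  have "[:x + 1, -1:] * (P m * ?S (P n)) =
    smult (x + 1 - b m) (P m * ?S (P n)) - P (Suc m) * ?S (P n) - smult (r m) (P (m - 1) * ?S (P n))"
    (is "?f = ?g")
  proof (rule poly_ext)
    fix y
    have "poly ?f y = ((x + 1) * poly (P m) y - y * poly (P m) y) * poly (P n) (y - 1)"
      by (simp add: algebra_simps)
    then show "poly ?f y = poly ?g y" unfolding t by (simp add: algebra_simps)
  qed
  then show "?A = ?R" unfolding R[symmetric] by (simp add: M_def G_diff G_smult)
  have "[:x + 1, -1:] * (P m * ?S (P n)) =
    smult (x - b n) (P m * ?S (P n)) - P m * ?S (P (Suc n)) - smult (r n) (P m * ?S (P (n - 1)))"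
    (is "?f = ?g")
  proof (rule poly_ext)
    fix y
    have "poly ?f y = (x * poly (P n) (y - 1) - (y - 1) * poly (P n) (y - 1)) * poly (P m) y"
      by (simp add: algebra_simps)
    then show "poly ?f y = poly ?g y" unfolding t by (simp add: algebra_simps)
  qed
  then show "?B = ?R" unfolding R[symmetric] by (simp add: M_def G_diff G_smult)
qed

text \<open>In orthonormal terms, \<open>g n\<close> is \<open>\<psi>\<close> times A_n / a_n, while
  \<open>e n\<close> and \<open>f n\<close> are \<open>\<psi>\<close> times a_n times the sums with
  p_n(k) p_{n-1}(k-1) and p_{n-1}(k) p_n(k-1). The factor \<open>r n\<close> makes \<open>e\<close>
  and \<open>f\<close> vanish at 0, where the telescoping starts.\<close>

definition g where "g n x = M x n n / h n"
definition e where "e n x = r n * M x n (n - 1) / h n"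
definition f where "f n x = r n * M x (n - 1) n / h n"

lemma h_neq [simp]: "h n \<noteq> 0"
  using h_pos[of n] by simp

lemma e_Suc: "e (Suc n) x = M x (Suc n) n / h n"
  by (simp add: e_def r_def)

lemma f_Suc: "f (Suc n) x = M x n (Suc n) / h n"
  by (simp add: f_def r_def)

lemma e_f_0 [simp]: "e 0 x = 0" "f 0 x = 0" "r 0 = 0"
  by (simp_all add: e_def f_def r_def)

lemma ladder:
  shows "(x + 1 - b n) * g n x - e (Suc n) x - f n x = \<phi> x - \<psi> x"
    and "(x - b n) * g n x - f (Suc n) x - e n x = \<phi> x - \<psi> x"
proof -
  have "((x + 1 - b n) * M x n n - M x (Suc n) n - r n * M x (n - 1) n) / h n = \<phi> x - \<psi> x"
    unfolding M_three_term(1) by (simp add: L_P_shift mult.commute[of "shift_poly _ _"] diff_divide_distrib)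
  then show "(x + 1 - b n) * g n x - e (Suc n) x - f n x = \<phi> x - \<psi> x"
    by (simp add: e_Suc g_def f_def diff_divide_distrib)
  have "((x - b n) * M x n n - M x n (Suc n) - r n * M x n (n - 1)) / h n = \<phi> x - \<psi> x"
    unfolding M_three_term(2) by (simp add: L_P_shift mult.commute[of "shift_poly _ _"] diff_divide_distrib)
  then show "(x - b n) * g n x - f (Suc n) x - e n x = \<phi> x - \<psi> x"
    by (simp add: f_Suc g_def e_def diff_divide_distrib)
qed

text \<open>Subtracting the two ladder relations cancels \<open>b n\<close>, \<open>\<phi>\<close>
  and \<open>\<psi>\<close>. Hence sums of \<open>g\<close> telescope.\<close>

lemma g_eq: "g n x = (e (Suc n) x - f (Suc n) x) - (e n x - f n x)"
  using ladder[of x n] by (simp add: algebra_simps)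

text \<open>Apply the recurrence in the second index at \<open>(Suc n, n)\<close> and in the first
  index at \<open>(n, n - 1)\<close>. Both contain \<open>M x (Suc n) (n - 1)\<close>, which is
  eliminated.\<close>

lemma compat:
  "(x - b n) * e (Suc n) x - (x + 1 - b n) * e n x + \<psi> x = r (Suc n) * g (Suc n) x - r n * g (n - 1) x"
proof -
  have 1: "(x - b n) * M x (Suc n) n - M x (Suc n) (Suc n) - r n * M x (Suc n) (n - 1)
      = - (real n + 1) * h n * \<psi> x"
    unfolding M_three_term(2) by (simp add: L_P_shift mult.commute[of "shift_poly _ _"] algebra_simps)
  have 2: "r n * ((x + 1 - b n) * M x n (n - 1) - M x (Suc n) (n - 1) - r n * M x (n - 1) (n - 1))
     = - real n * h n * \<psi> x"
  proof (cases n)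
    case (Suc m)
    have rn: "r n = h n / h m" by (simp add: r_def Suc)
    show ?thesis unfolding M_three_term(1)
      by (simp add: Suc L_P_shift mult.commute[of "shift_poly _ _"] rn[unfolded Suc] algebra_simps)
  qed simp
  have rr: "r n * (r n * M x (n - 1) (n - 1)) / h n = r n * g (n - 1) x"
    by (cases n) (auto simp: g_def r_def)
  have "((x - b n) * M x (Suc n) n - M x (Suc n) (Suc n)
      - r n * ((x + 1 - b n) * M x n (n - 1)) + r n * (r n * M x (n - 1) (n - 1))) / h n = - \<psi> x"
    using 1 2 by (simp add: field_simps)
  then have "(x - b n) * e (Suc n) x - M x (Suc n) (Suc n) / h n
      - (x + 1 - b n) * e n x + r n * g (n - 1) x = - \<psi> x"
    unfolding rr[symmetric] by (simp add: e_Suc e_def[of n] add_divide_distrib diff_divide_distrib mult_ac)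
  moreover have "M x (Suc n) (Suc n) / h n = r (Suc n) * g (Suc n) x"
    by (simp add: g_def r_def)
  ultimately show ?thesis by simp
qed

text \<open>Summing \<open>compat\<close> times \<open>g n x\<close> over \<open>n\<close> telescopes. This is the determinant of the
  \<open>2 \<times> 2\<close> matrix that shifts \<open>x\<close> by one in \<open>(P\<^sub>n, P\<^sub>n\<^sub>-\<^sub>1)\<close>.\<close>

lemma det_identity:
  "r n * g n x * g (n - 1) x = \<phi> x * e n x - \<psi> x * f n x + e n x * f n x"
proof (induction n)
  case (Suc n)
  have l1: "(x - b n) * g n x = \<phi> x - \<psi> x + f (Suc n) x + e n x"
    and l2: "(x + 1 - b n) * g n x = \<phi> x - \<psi> x + e (Suc n) x + f n x"
    using ladder[of x n] by linarith+
  have "r (Suc n) * g (Suc n) x * g n x = g n x * (r n * g (n - 1) x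
      + ((x - b n) * e (Suc n) x - (x + 1 - b n) * e n x + \<psi> x))"
    unfolding compat by (simp add: mult_ac)
  also have "\<dots> = r n * g n x * g (n - 1) x + ((x - b n) * g n x) * e (Suc n) x
      - ((x + 1 - b n) * g n x) * e n x + \<psi> x * g n x"
    by (simp add: algebra_simps)
  also have "\<dots> = \<phi> x * e n x - \<psi> x * f n x + e n x * f n x
      + (\<phi> x - \<psi> x + f (Suc n) x + e n x) * e (Suc n) x
      - (\<phi> x - \<psi> x + e (Suc n) x + f n x) * e n x + \<psi> x * g n x"
    unfolding l1 l2 Suc ..
  also have "\<dots> = \<phi> x * e (Suc n) x - \<psi> x * f (Suc n) x + e (Suc n) x * f (Suc n) x"
    unfolding g_eq by (simp add: algebra_simps)
  finally show ?case by simp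
qed simp

section \<open>Affine dependence on x and comparison of coefficients\<close>

lemma G_linear:
  "G x q = x * (L q / c - L (shift_poly 1 q)) + G 0 q"
proof -
  have "[:x + u, 1:] * p = smult x p + [:u, 1:] * p" for u and p :: "real poly"
    by (simp add: algebra_simps smult_add_left)
  then show ?thesis
    unfolding G_def by (simp add: L_add L_smult add_divide_distrib right_diff_distrib add.assoc
        del: mult_pCons_left)
qed

text \<open>By \<open>G_linear\<close> the slope of an \<open>M\<close> is a combination of values
  from \<open>L_P_shift\<close>. So \<open>g\<close>, \<open>e\<close> and \<open>f\<close> each
  keep a single unknown, the value at 0.\<close>

lemma g_linear: "g n x = (1 / c - 1) * x + g n 0"
proof -
  have "g n x = (x * (h n / c - h n) + G 0 (P n * shift_poly (- 1) (P n))) / h n"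
    unfolding g_def M_def G_linear[of x] shift_poly_mult shift_poly_inverse[of 1]
    by (simp add: L_P_shift mult.commute[of "shift_poly _ _"])
  then show ?thesis by (simp add: g_def M_def field_simps)
qed

lemma e_linear: "e n x = - real n * x + e n 0"
proof (cases n)
  case (Suc m)
  have "e (Suc m) x = (x * (- (real m + 1) * h m) + G 0 (P (Suc m) * shift_poly (- 1) (P m))) / h m"
    unfolding e_Suc M_def G_linear[of x] shift_poly_mult shift_poly_inverse[of 1]
    by (simp add: L_P_shift mult.commute[of "shift_poly _ _"] algebra_simps)
  then show ?thesis by (simp add: Suc e_Suc M_def field_simps)
qed simp

lemma f_linear: "f n x = - (real n / c) * x + f n 0"
proof (cases n)
  case (Suc m)
  have "f (Suc m) x = (x * (- (real m + 1) * h m / c) + G 0 (P m * shift_poly (- 1) (P (Suc m)))) / h m"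
    unfolding f_Suc M_def G_linear[of x] shift_poly_mult shift_poly_inverse[of 1]
    by (simp add: L_P_shift L_P_lower_degree mult.commute[of "shift_poly _ _"])
  then show ?thesis using c by (simp add: Suc f_Suc M_def field_simps)
qed simp

definition xi :: "nat \<Rightarrow> real" where "xi n = c * g n 0 / (1 - c)"

lemma g_xi: "g n x = (1 - c) / c * (x + xi n)"
  unfolding xi_def g_linear[of n x] using c by (simp add: field_simps)

text \<open>This is the coefficient of \<open>x\<close> in the second ladder relation: the quadratic
  terms cancel, and the values at 1 and -1 isolate the linear one.\<close>

lemma xi_eq: "(1 - c) * xi n = (1 - c) * b n + \<gamma> - real n - c * (\<alpha> + \<beta> + real n)"
proof -
  have *: "(x - b n) * ((1 - c) * (x + xi n)) - (c * f (Suc n) 0 - (real n + 1) * x)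
      - c * (e n 0 - real n * x) - (x + \<gamma>) * (x + 1) + c * ((x + \<alpha>) * (x + \<beta>)) = 0" for x
  proof -
    have 1: "c * g n x = (1 - c) * (x + xi n)" "c * f (Suc n) x = c * f (Suc n) 0 - (real n + 1) * x"
      "c * \<phi> x = (x + \<gamma>) * (x + 1)" "e n x = e n 0 - real n * x"
      unfolding f_linear[of "Suc n" x] g_xi \<phi>_def using c
      by (simp_all add: e_linear[of n x] field_simps)
    have "(x - b n) * (c * g n x) - c * f (Suc n) x - c * e n x - c * \<phi> x + c * \<psi> x
      = c * ((x - b n) * g n x - f (Suc n) x - e n x - \<phi> x + \<psi> x)"
      by (simp add: algebra_simps)
    also have "\<dots> = 0" using ladder(2)[of x n] by simp
    finally show ?thesis unfolding 1 \<psi>_def .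
  qed
  show ?thesis
    using *[of 1] *[of "- 1"] by (simp add: algebra_simps)
qed

lemma e_diff_f: "c * (e n 0 - f n 0) = (1 - c) * (\<Sum>k<n. xi k)"
proof (induction n)
  case (Suc n)
  then show ?case
    using g_eq[of n 0] c by (simp add: g_xi field_simps)
qed simp

text \<open>Summation of \<open>xi_eq\<close> over the index. It replaces the sum of the
  \<open>xi k\<close> by \<open>B n\<close>, whose derivative in \<open>c\<close> is
  accessible.\<close>

lemma sum_xi:
  "(1 - c) * (\<Sum>k<n. xi k) = (1 - c) * B n + real n * \<gamma> - real n * (real n - 1) / 2
    - c * ((\<alpha> + \<beta>) * real n + real n * (real n - 1) / 2)"
proof (induction n)
  case 0
  then show ?case by (simp add: B_def)
next
  case (Suc n)
  have "(1 - c) * xi n = (1 - c) * B (Suc n) - (1 - c) * B n + \<gamma> - real n - c * (\<alpha> + \<beta> + real n)"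
    using xi_eq[of n] by (simp add: b_eq_B algebra_simps)
  then show ?case using Suc by (simp add: field_simps)
qed

text \<open>The cubic terms in \<open>det_identity\<close> cancel. The three claims are the
  coefficients of the remaining quadratic in \<open>x\<close>, recovered from its values at 0, 1 and
  -1.\<close>

lemma det_coeffs:
  fixes n :: nat
  assumes "n > 0"
  defines "R \<equiv> ((1 - c) / c)\<^sup>2 * r n" and "E \<equiv> e n 0" and "F \<equiv> c * f n 0"
  shows "c * R = E - F + real n * (\<alpha> + \<beta> - \<gamma> - 1 + real n)"
    and "c * R * (xi n + xi (n - 1)) = - (\<alpha> * \<beta> - E) * (\<gamma> + 1 - real n)
      - (\<alpha> + \<beta> + real n) * (\<gamma> + F) + \<alpha> * \<beta> * (\<gamma> + 1) + \<gamma> * (\<alpha> + \<beta>)"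
    and "c * R * (xi n * xi (n - 1)) = - (\<alpha> * \<beta> - E) * (\<gamma> + F) + \<alpha> * \<beta> * \<gamma>"
proof -
  have f0: "f n 0 = F / c" using c by (simp add: F_def)
  have *: "c * R * (x + xi n) * (x + xi (n - 1)) =
     (x + \<gamma>) * (x + 1) * (E - real n * x) - (x + \<alpha>) * (x + \<beta>) * (F - real n * x)
     + (E - real n * x) * (F - real n * x)" for x
  proof -
    have 1: "c * f n x = F - real n * x" "c * \<phi> x = (x + \<gamma>) * (x + 1)" "e n x = E - real n * x"
      unfolding f_linear[of n x] f0 \<phi>_def E_def using c
      by (simp_all add: e_linear[of n x] field_simps)
    have "c * R * (x + xi n) * (x + xi (n - 1)) = c * (r n * g n x * g (n - 1) x)"
      by (simp add: g_xi R_def power2_eq_square)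
    also have "\<dots> = (c * \<phi> x) * e n x - \<psi> x * (c * f n x) + e n x * (c * f n x)"
      unfolding det_identity by (simp add: algebra_simps)
    finally show ?thesis unfolding 1 \<psi>_def by (simp add: mult.commute)
  qed
  note eqs = *[of 0] *[of 1] *[of "-1"]
  show 0: "c * R * (xi n * xi (n - 1)) = - (\<alpha> * \<beta> - E) * (\<gamma> + F) + \<alpha> * \<beta> * \<gamma>"
    using eqs(1) by (simp add: algebra_simps)
  show "c * R = E - F + real n * (\<alpha> + \<beta> - \<gamma> - 1 + real n)"
    using eqs by (simp add: algebra_simps)
  show "c * R * (xi n + xi (n - 1)) = - (\<alpha> * \<beta> - E) * (\<gamma> + 1 - real n)
      - (\<alpha> + \<beta> + real n) * (\<gamma> + F) + \<alpha> * \<beta> * (\<gamma> + 1) + \<gamma> * (\<alpha> + \<beta>)"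
    using eqs by (simp add: algebra_simps)
qed

section \<open>Identification of \<open>xi\<close> with \<open>x_coeff\<close>\<close>

lemma kernel_identity:
  fixes W x j :: real
  assumes "x \<noteq> - \<alpha>" "x \<noteq> - \<beta>" "x \<noteq> j" "j \<ge> 0"
  shows "((\<gamma> + x) * (x + 1) / (c * (\<alpha> + x) * (\<beta> + x)) - (\<gamma> + j) * (j + 1) / (c * (\<alpha> + j) * (\<beta> + j))) / (x - j)
    = ((x + j + 1 + \<gamma>) / c - (x + \<alpha> + \<beta> + j) * ((\<gamma> + j) * (j + 1) / (c * (\<alpha> + j) * (\<beta> + j)))) / \<psi> x"
proof -
  define N1 N2 D where "N1 = (\<gamma> + x) * (x + 1)" and "N2 = (\<gamma> + j) * (j + 1)" and "D = (\<alpha> + j) * (\<beta> + j)"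
  have nz: "\<psi> x \<noteq> 0" "D \<noteq> 0" "c \<noteq> 0" "x - j \<noteq> 0"
    using assms pos c by (auto simp: \<psi>_def D_def add_eq_0_iff2)
  \<comment> \<open>Write the left side as \<open>(N1 - N2) * D - N2 * (\<psi> x - D)\<close>; both
    differences are divisible by \<open>x - j\<close>.\<close>
  have "N1 * D - N2 * \<psi> x = (x - j) * ((x + j + 1 + \<gamma>) * D - (x + \<alpha> + \<beta> + j) * N2)"
    unfolding N1_def N2_def D_def \<psi>_def by algebra
  then have "(N1 / (c * \<psi> x) - N2 / (c * D)) / (x - j)
    = ((x + j + 1 + \<gamma>) / c - (x + \<alpha> + \<beta> + j) * (N2 / (c * D))) / \<psi> x"
    using nz by (simp add: divide_simps)
  then show ?thesis by (simp add: N1_def N2_def D_def \<psi>_def mult_ac add_ac)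
qed

lemma A_ratio_eq:
  assumes x: "x \<noteq> - \<alpha>" "x \<noteq> - \<beta>" "x + 1 \<notin> \<nat>"
    and p: "p n = smult a (P n)" "a\<^sup>2 * h n = 1"
  shows "A_ratio \<alpha> \<beta> \<gamma> c p n x = g n x / \<psi> x"
proof -
  let ?w = "hyp_weight \<alpha> \<beta> \<gamma> c"
  define q where "q = P n * shift_poly (- 1) (P n)"
  \<comment> \<open>\<open>u\<close> and \<open>v\<close> are the summands of the two parts of
    \<open>G x q\<close>. The second part carries the weight of the preceding node, hence the index
    shift in \<open>v\<close> and its value 0 at 0.\<close>
  define u where "u k = poly ([:x + \<gamma>, 1:] * q) (real k) * ?w k / c" for k
  define v where "v k = (case k of 0 \<Rightarrow> 0
    | Suc j \<Rightarrow> poly ([:x + \<alpha> + \<beta>, 1:] * shift_poly 1 q) (real j) * ?w j)" for k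
  define t where "t k = poly (P n) (real k) * poly (P n) (real k - 1)
          * ((potential \<alpha> \<beta> \<gamma> c (x + 1) - potential \<alpha> \<beta> \<gamma> c (real k)) / (x + 1 - real k)) * ?w k" for k
  have x0: "x + 1 \<noteq> 0" and xj: "x \<noteq> real j" for j
    using x(3) by (metis Nats_0, metis Nats_1 Nats_add of_nat_in_Nats)
  have nz: "\<psi> x \<noteq> 0" "c \<noteq> 0" using x c by (auto simp: \<psi>_def)
  have "t k = (u k - v k) / \<psi> x" for k
  proof (cases k)
    \<comment> \<open>The convention u(0) = -1 is exactly what makes the term at 0 fit with
      \<open>v 0 = 0\<close>.\<close>
    case 0
    have "(potential \<alpha> \<beta> \<gamma> c (x + 1) - potential \<alpha> \<beta> \<gamma> c 0) / (x + 1) = (x + \<gamma>) / c / \<psi> x"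
    proof -
      have "potential \<alpha> \<beta> \<gamma> c (x + 1) - potential \<alpha> \<beta> \<gamma> c 0 = (x + 1) * ((x + \<gamma>) / c / \<psi> x)"
        using x0 by (simp add: potential_def \<psi>_def add_ac mult_ac)
      then show ?thesis using x0 by simp
    qed
    then show ?thesis by (simp add: 0 t_def u_def v_def q_def)
  next
    case (Suc j)
    have d: "(\<alpha> + real j) * (\<beta> + real j) \<noteq> 0" using pos by (simp add: add_eq_0_iff2)
    have wj: "?w j = ?w k * ((\<gamma> + real j) * (real j + 1) / (c * (\<alpha> + real j) * (\<beta> + real j)))"
    proof -
      have "?w k * ((\<gamma> + real j) * (real j + 1)) = ?w j * (c * ((\<alpha> + real j) * (\<beta> + real j)))"
        using hyp_weight_Suc[OF pos(3), of j \<alpha> \<beta> c] by (simp add: Suc mult_ac)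
      moreover have "c * ((\<alpha> + real j) * (\<beta> + real j)) \<noteq> 0" using d nz by simp
      ultimately show ?thesis by (metis nonzero_eq_divide_eq times_divide_eq_right mult.assoc)
    qed
    have "(potential \<alpha> \<beta> \<gamma> c (x + 1) - potential \<alpha> \<beta> \<gamma> c (real k)) / (x + 1 - real k)
      = ((x + real j + 1 + \<gamma>) / c - (x + \<alpha> + \<beta> + real j)
          * ((\<gamma> + real j) * (real j + 1) / (c * (\<alpha> + real j) * (\<beta> + real j)))) / \<psi> x"
      using kernel_identity[OF x(1,2) xj[of j]] x0 by (simp add: potential_def Suc add_ac)
    then show ?thesis unfolding t_def u_def v_def wj q_def
      by (simp add: Suc wj) (simp add: algebra_simps diff_divide_distrib add_divide_distrib)
  qed
  moreover have "u sums (L ([:x + \<gamma>, 1:] * q) / c)"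
    unfolding u_def wsum_def by (intro sums_divide summable_sums summ)
  moreover have "v sums (L ([:x + \<alpha> + \<beta>, 1:] * shift_poly 1 q))"
  proof -
    have "(\<lambda>k. v (Suc k)) sums (L ([:x + \<alpha> + \<beta>, 1:] * shift_poly 1 q))"
      unfolding v_def wsum_def nat.case by (intro summable_sums summ)
    moreover have "v 0 = 0" by (simp add: v_def)
    ultimately show ?thesis unfolding sums_Suc_iff by simp
  qed
  ultimately have "(\<lambda>k. (u k - v k) / \<psi> x) sums (G x q / \<psi> x)" and "t = (\<lambda>k. (u k - v k) / \<psi> x)"
    unfolding G_def by (auto intro!: sums_divide sums_diff simp del: mult_pCons_left)
  then have "t sums (G x q / \<psi> x)" by simp
  then have "(\<lambda>k. a\<^sup>2 * t k) sums (a\<^sup>2 * (G x q / \<psi> x))" by (rule sums_mult)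
  moreover have "a\<^sup>2 * t k = poly (p n) (real k) * poly (p n) (real k - 1)
          * ((potential \<alpha> \<beta> \<gamma> c (x + 1) - potential \<alpha> \<beta> \<gamma> c (real k)) / (x + 1 - real k)) * ?w k" for k
    by (simp add: t_def p power2_eq_square)
  moreover have "a\<^sup>2 * (G x q / \<psi> x) = g n x / \<psi> x"
    using p(2) nonzero_eq_divide_eq[of "h n" "a\<^sup>2" 1] by (simp add: g_def M_def q_def)
  ultimately show ?thesis
    unfolding A_ratio_def by (simp add: sums_iff)
qed

lemma x_coeff_eq:
  assumes p: "p n = smult a (P n)" "a\<^sup>2 * h n = 1"
  shows "x_coeff \<alpha> \<beta> \<gamma> c p n = xi n"
  unfolding x_coeff_def
proof (rule the_equality)
  show "\<forall>x. x \<noteq> - \<alpha> \<and> x \<noteq> - \<beta> \<and> x + 1 \<notin> \<nat> \<longrightarrow>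
    A_ratio \<alpha> \<beta> \<gamma> c p n x = (1 - c) / c * ((x + xi n) / ((x + \<alpha>) * (x + \<beta>)))"
    using A_ratio_eq[of _ p n a] p by (simp add: g_xi \<psi>_def)
next
  fix \<xi>
  assume *: "\<forall>x. x \<noteq> - \<alpha> \<and> x \<noteq> - \<beta> \<and> x + 1 \<notin> \<nat> \<longrightarrow>
    A_ratio \<alpha> \<beta> \<gamma> c p n x = (1 - c) / c * ((x + \<xi>) / ((x + \<alpha>) * (x + \<beta>)))"
  \<comment> \<open>One admissible point determines the constant; this one lies left of both poles
    and of all nodes.\<close>
  define x where "x = - 2 - \<alpha> - \<beta>"
  have "x + 1 < 0" using pos by (simp add: x_def)
  then have "x + 1 \<notin> \<nat>" by (metis Nats_cases of_nat_0_le_iff not_le)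
  moreover have ne: "x \<noteq> - \<alpha>" "x \<noteq> - \<beta>" using pos by (auto simp: x_def)
  ultimately have "(1 - c) / c * ((x + \<xi>) / ((x + \<alpha>) * (x + \<beta>)))
    = (1 - c) / c * ((x + xi n) / ((x + \<alpha>) * (x + \<beta>)))"
    using * A_ratio_eq[of x p n a] p by (simp add: g_xi \<psi>_def)
  moreover have "(x + \<alpha>) * (x + \<beta>) \<noteq> 0" "(1 - c) / c \<noteq> 0" using ne c by auto
  ultimately show "\<xi> = xi n" by simp
qed

end

section \<open>Dependence on the parameter: the Toda equations\<close>

text \<open>A power series in \<open>c\<close> is differentiated termwise; the factor
  \<open>k\<close> raises the order of the moment, and the term at 0 of the higher moment
  vanishes.\<close>

lemma moment_deriv:
  assumes c: "0 < c" "c < 1"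
    and s: "\<And>c f. 0 < c \<Longrightarrow> c < 1 \<Longrightarrow> summable (\<lambda>k. poly f (real k) * hyp_weight \<alpha> \<beta> \<gamma> c k)"
  shows "((\<lambda>c. wsum (hyp_weight \<alpha> \<beta> \<gamma> c) (monom 1 j)) has_real_derivative
    wsum (hyp_weight \<alpha> \<beta> \<gamma> c) (monom 1 (Suc j)) / c) (at c)"
proof -
  define v where "v k = pochhammer \<alpha> k * pochhammer \<beta> k / (pochhammer \<gamma> k * fact k)" for k
  define a where "a k = real k ^ j * v k" for k
  have w: "hyp_weight \<alpha> \<beta> \<gamma> c k = v k * c ^ k" for c k by (simp add: hyp_weight_def v_def)
  \<comment> \<open>A point between \<open>c\<close> and 1: convergence there puts \<open>c\<close>
    inside the disc of convergence.\<close>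
  define K where "K = (c + 1) / 2"
  have K: "0 < K" "K < 1" "c < K" using c by (auto simp: K_def)
  have "summable (\<lambda>k. a k * K ^ k)"
    using s[OF K(1,2), of "monom 1 j"] by (simp add: poly_monom w a_def mult_ac)
  then have "((\<lambda>c. \<Sum>k. a k * c ^ k) has_real_derivative (\<Sum>k. diffs a k * c ^ k)) (at c)"
    by (rule termdiffs_strong) (use K c in auto)
  moreover have "(\<lambda>c. \<Sum>k. a k * c ^ k) = (\<lambda>c. wsum (hyp_weight \<alpha> \<beta> \<gamma> c) (monom 1 j))"
    by (simp add: wsum_def poly_monom w a_def mult_ac)
  moreover have "(\<Sum>k. diffs a k * c ^ k) = wsum (hyp_weight \<alpha> \<beta> \<gamma> c) (monom 1 (Suc j)) / c"
  proof -
    let ?g = "\<lambda>k. poly (monom 1 (Suc j)) (real k) * hyp_weight \<alpha> \<beta> \<gamma> c k"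
    have "diffs a k * c ^ k = ?g (Suc k) / c" for k
      using c by (simp add: diffs_def a_def w poly_monom)
    moreover have "(\<Sum>k. ?g (Suc k)) = suminf ?g"
      using suminf_split_head[OF s[OF c, of "monom 1 (Suc j)"]] by (simp add: poly_monom)
    moreover have "summable (\<lambda>k. ?g (Suc k))"
      using s[OF c, of "monom 1 (Suc j)"] by (subst summable_Suc_iff)
    ultimately show ?thesis unfolding wsum_def
      using suminf_divide[of "\<lambda>k. ?g (Suc k)" c] by simp
  qed
  ultimately show ?thesis by simp
qed

lemma differentiable_on_eq:
  assumes "f differentiable_on S" "\<And>x. x \<in> S \<Longrightarrow> g x = f x"
  shows "g differentiable_on S"
  using assms differentiable_transform_within[of f _ S 1 g] unfolding differentiable_on_def
  by (metis zero_less_one)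

text \<open>Here \<open>s = \<sigma>'\<close> and \<open>sg = \<sigma> - c \<sigma>'\<close>, so that \<open>2 \<sigma> - (2 c - 1) \<sigma>' = 2 sg + s\<close> is free of \<open>c\<close>, and
  \<open>Y1\<^sup>2 - 4 Y2 Y0\<close> is the value of \<open>(c (c - 1) \<sigma>'')\<^sup>2\<close>.\<close>

lemma sigma_identity:
  fixes \<alpha> \<beta> \<gamma> n s F l sg Y0 Y1 Y2 E d1 d2 d3 d4 :: real
  assumes "E = \<alpha> * \<beta> - 1 / 4 * (\<alpha> + \<beta> + n)\<^sup>2 - s"
    and "sg = F + l"
    and "l = 1 / 4 * ((\<alpha> + \<beta> + \<gamma> + 1) * n + \<alpha>\<^sup>2 + \<beta>\<^sup>2 - (\<alpha> + \<beta>) * (\<gamma> + 1) + 2 * \<gamma>)"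
    and "Y2 = E - F + n * (\<alpha> + \<beta> - \<gamma> - 1 + n)"
    and "Y1 = - (\<alpha> * \<beta> - E) * (\<gamma> + 1 - n)
      - (\<alpha> + \<beta> + n) * (\<gamma> + F) + \<alpha> * \<beta> * (\<gamma> + 1) + \<gamma> * (\<alpha> + \<beta>)"
    and "Y0 = - (\<alpha> * \<beta> - E) * (\<gamma> + F) + \<alpha> * \<beta> * \<gamma>"
    and "d1 = (n + \<alpha> - \<beta>) / 2" "d2 = (- n + \<alpha> - \<beta>) / 2"
      "d3 = (n + \<alpha> + \<beta> - 2) / 2" "d4 = (n + \<alpha> + \<beta> - 2 * \<gamma>) / 2"
  shows "s * (Y1\<^sup>2 - 4 * Y2 * Y0) + (s * (2 * sg + s) + d1 * d2 * d3 * d4)\<^sup>2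
    = (s + d1\<^sup>2) * (s + d2\<^sup>2) * (s + d3\<^sup>2) * (s + d4\<^sup>2)"
proof -
  \<comment> \<open>Solving for the original parameters turns the claim into a polynomial identity
    in \<open>d1\<close>, \<open>d2\<close>, \<open>d3\<close>, \<open>d4\<close>, \<open>s\<close>
    and \<open>F\<close>.\<close>
  have 1: "n = d1 - d2" "\<alpha> = (2 * d2 + 2 * d3 + 2) / 2" "\<beta> = d3 - d1 + 1" "\<gamma> = d3 - d4 + 1"
    using assms by (simp_all add: field_simps)
  show ?thesis unfolding assms(1-6) unfolding 1 by algebra
qed

text \<open>Nothing is known about \<open>P c\<close> and \<open>h c\<close> for \<open>c\<close>
  outside the open interval, so identities in \<open>c\<close> are differentiated by transfer within
  that open set.\<close>

locale hyp_family =
  fixes \<alpha> \<beta> \<gamma> :: real and P :: "real \<Rightarrow> nat \<Rightarrow> real poly" and h :: "real \<Rightarrow> nat \<Rightarrow> real"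
  assumes hyp: "\<And>c. c \<in> {0<..<1} \<Longrightarrow> hyp_ops \<alpha> \<beta> \<gamma> c (P c) (h c)"
begin

abbreviation I :: "real set" where "I \<equiv> {0<..<1}"
abbreviation w where "w c \<equiv> hyp_weight \<alpha> \<beta> \<gamma> c"
abbreviation \<mu> where "\<mu> c j \<equiv> wsum (w c) (monom 1 j)"
abbreviation B_at where "B_at c \<equiv> monic_ops.B (P c)"
abbreviation b_at where "b_at c \<equiv> monic_ops.b (w c) (P c) (h c)"
abbreviation r_at where "r_at c \<equiv> monic_ops.r (h c)"

lemma ops: "c \<in> I \<Longrightarrow> monic_ops (w c) (P c) (h c)"
  using hyp hyp_ops.axioms(1) by blast

lemma \<mu>_deriv: "c \<in> I \<Longrightarrow> ((\<lambda>c. \<mu> c j) has_real_derivative \<mu> c (Suc j) / c) (at c)"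
  by (rule moment_deriv) (use ops monic_ops.summ in force)+

lemma differentiable_\<mu>: "(\<lambda>c. \<mu> c j) differentiable_on I"
  unfolding differentiable_on_def
  using \<mu>_deriv real_differentiable_def differentiable_at_withinI by blast

text \<open>The Toda computation needs these derivatives to exist. Moments are differentiable; from
  the \<open>P c m\<close> with \<open>m < n\<close> one obtains \<open>h\<close>, then
  \<open>b\<close> and \<open>r\<close>, and the recurrence passes this on to
  \<open>P c n\<close>.\<close>

lemma differentiable_coeffs: "(\<lambda>c. coeff (P c n) i) differentiable_on I"
proof (induction n arbitrary: i rule: less_induct)
  case (less n)
  have h: "(\<lambda>c. h c m) differentiable_on I" if "m < n" for m
  proof (rule differentiable_on_eq)
    show "(\<lambda>c. \<Sum>i\<le>m. coeff (P c m) i * \<mu> c (i + m)) differentiable_on I"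
      using less[OF that] differentiable_\<mu>
      unfolding differentiable_on_def by (auto intro!: differentiable_sum differentiable_mult)
  qed (use ops monic_ops.h_eq in blast)
  have h0: "h c m \<noteq> 0" if "c \<in> I" for c m
    using monic_ops.h_pos[OF ops[OF that], of m] by simp
  show ?case
  proof (cases n)
    case 0
    have "coeff (P c n) i = (if i = 0 then 1 else 0)" if "c \<in> I" for c
      using monic_ops.monic[OF ops[OF that], of 0] monic_ops.deg[OF ops[OF that], of 0]
      by (auto simp: 0 coeff_eq_0)
    then show ?thesis by (rule differentiable_on_eq[OF differentiable_on_const])
  next
    case (Suc m)
    have B: "(\<lambda>c. B_at c k) differentiable_on I" if "k \<le> m" for k
    proof (rule differentiable_on_eq)
      show "(\<lambda>c. if k = 0 then 0 else - coeff (P c k) (k - 1)) differentiable_on I"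
        using less[of k] that Suc by (cases "k = 0") (auto simp: differentiable_on_def)
    qed (use ops monic_ops.B_def in blast)
    have "(\<lambda>c. \<Sum>i\<le>m. coeff (P c m) i * \<mu> c (Suc (i + m))) differentiable_on I"
      using less[of m] differentiable_\<mu> Suc
      unfolding differentiable_on_def by (auto intro!: differentiable_sum differentiable_mult)
    \<comment> \<open>\<open>B_at c (Suc m)\<close> is a coefficient of the polynomial still to be
      treated, so it is expressed through \<open>P c m\<close> and moments.\<close>
    moreover have hB: "h c m * B_at c (Suc m) = (\<Sum>i\<le>m. coeff (P c m) i * \<mu> c (Suc (i + m)))"
      if "c \<in> I" for c
    proof -
      interpret monic_ops "w c" "P c" "h c" by (rule ops[OF that])
      show ?thesis using L_mult_expand[of "P c m" m "monom 1 (Suc m)"] L_P_monom_Suc[of m]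
        by (simp add: mult_monom mult.commute add.commute)
    qed
    moreover have hm: "(\<lambda>c. h c m) differentiable_on I" using h Suc by simp
    ultimately have "(\<lambda>c. (\<Sum>i\<le>m. coeff (P c m) i * \<mu> c (Suc (i + m))) / h c m - B_at c m) differentiable_on I"
      using B[of m] h0 unfolding differentiable_on_def
      by (auto intro!: differentiable_diff differentiable_divide)
    then have b: "(\<lambda>c. b_at c m) differentiable_on I"
    proof (rule differentiable_on_eq)
      fix c assume "c \<in> I"
      then show "b_at c m = (\<Sum>i\<le>m. coeff (P c m) i * \<mu> c (Suc (i + m))) / h c m - B_at c m"
        using monic_ops.b_eq_B[OF ops, of c m] hB[of c] h0[of c m]
        by (simp add: nonzero_eq_divide_eq mult.commute)
    qed
    have r: "(\<lambda>c. r_at c m) differentiable_on I"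
    proof (rule differentiable_on_eq)
      show "(\<lambda>c. if m = 0 then 0 else h c m / h c (m - 1)) differentiable_on I"
        using h[of m] h[of "m - 1"] h0 Suc unfolding differentiable_on_def
        by (cases "m = 0") (auto intro!: differentiable_divide)
    qed (use ops monic_ops.r_def in blast)
    have "(\<lambda>c. (if i = 0 then 0 else coeff (P c m) (i - 1)) - b_at c m * coeff (P c m) i
        - r_at c m * coeff (P c (m - 1)) i) differentiable_on I"
      using b r less[of m] less[of "m - 1"] Suc
      by (cases "i = 0") (auto intro!: differentiable_on_diff differentiable_on_mult)
    then show ?thesis
    proof (rule differentiable_on_eq)
      fix c assume "c \<in> I"
      then interpret monic_ops "w c" "P c" "h c" by (rule ops)
      have "P c n = var_poly * P c m - smult (b m) (P c m) - smult (r m) (P c (m - 1))"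
        using three_term[of m] by (simp add: Suc)
      then show "coeff (P c n) i = (if i = 0 then 0 else coeff (P c m) (i - 1)) - b m * coeff (P c m) i
        - r m * coeff (P c (m - 1)) i"
        by (cases i) (simp_all add: coeff_var_poly_mult, simp add: var_poly_def)
    qed
  qed
qed

lemma moment_expansion:
  assumes "c \<in> I"
  shows "(\<Sum>i\<le>n. coeff (P c n) i * \<mu> c (i + m)) = wsum (w c) (P c n * monom 1 m)"
proof -
  interpret monic_ops "w c" "P c" "h c" by (rule ops[OF assms])
  show ?thesis using L_mult_expand[of "P c n" n "monom 1 m"]
    by (simp add: mult_monom mult.commute add.commute)
qed

text \<open>Let \<open>Q\<close> be the derivative of \<open>P c n\<close> in \<open>c\<close>.
  Differentiating the orthogonality to lower monomials shows that \<open>Q\<close> is orthogonal to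
  degrees below \<open>n - 1\<close> and has value \<open>- h c n / c\<close> against degree
  \<open>n - 1\<close>. This determines the top coefficient of \<open>Q\<close>, and then the
  derivative of the squared norm.\<close>

lemma Toda:
  assumes c: "c \<in> I"
  shows "((\<lambda>c. B_at c n) has_real_derivative r_at c n / c) (at c)"
    and "((\<lambda>c. h c n) has_real_derivative b_at c n * h c n / c) (at c)"
proof -
  interpret monic_ops "w c" "P c" "h c" by (rule ops[OF c])
  define q' where "q' i = deriv (\<lambda>c. coeff (P c n) i) c" for i
  have q': "((\<lambda>c. coeff (P c n) i) has_real_derivative q' i) (at c)" for i
  proof -
    have "(\<lambda>c. coeff (P c n) i) differentiable at c"
      using differentiable_coeffs[of n i] c by (simp add: differentiable_on_eq_differentiable_at)
    then show ?thesis by (simp add: q'_def DERIV_deriv_iff_real_differentiable)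
  qed
  \<comment> \<open>The leading coefficient is constantly 1, so \<open>Q\<close> has no term of
    degree \<open>n\<close>.\<close>
  have "((\<lambda>c. 1) has_real_derivative q' n) (at c)"
    by (rule has_field_derivative_transform_within_open[OF q' _ c])
      (auto simp: monic_ops.monic[OF ops])
  then have q'n: "q' n = 0" using DERIV_unique DERIV_const by blast
  define Q where "Q = (\<Sum>i<n. monom (q' i) i)"
  have coeff_Q: "coeff Q i = (if i < n then q' i else 0)" for i
    by (auto simp: Q_def coeff_sum)
  have F: "((\<lambda>c. \<Sum>i\<le>n. coeff (P c n) i * \<mu> c (i + m)) has_real_derivative
    L (Q * monom 1 m) + L (P c n * monom 1 (Suc m)) / c) (at c)" for m
  proof -
    have "((\<lambda>c. \<Sum>i\<le>n. coeff (P c n) i * \<mu> c (i + m)) has_real_derivative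
      (\<Sum>i\<le>n. q' i * \<mu> c (i + m) + coeff (P c n) i * (\<mu> c (Suc (i + m)) / c))) (at c)"
      by (intro DERIV_sum, rule DERIV_cong, rule DERIV_mult'[OF q' \<mu>_deriv[OF c]]) simp
    moreover have "(\<Sum>i\<le>n. q' i * \<mu> c (i + m)) = L (monom 1 m * Q)"
      using q'n by (subst L_mult_expand[of Q n])
        (auto intro!: sum.cong degree_le simp: coeff_Q mult_monom add.commute)
    moreover have "(\<Sum>i\<le>n. coeff (P c n) i * \<mu> c (Suc (i + m))) = L (monom 1 (Suc m) * P c n)"
      by (subst L_mult_expand[of "P c n" n]) (auto simp: mult_monom add.commute)
    ultimately show ?thesis
      by (simp add: sum.distrib mult.commute sum_divide_distrib[symmetric])
  qed
  have low: "L (Q * monom 1 m) = - L (P c n * monom 1 (Suc m)) / c" if m: "m < n" for m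
  proof -
    have "((\<lambda>c. 0) has_real_derivative L (Q * monom 1 m) + L (P c n * monom 1 (Suc m)) / c) (at c)"
    proof (rule has_field_derivative_transform_within_open[OF F _ c])
      fix c assume "c \<in> I"
      then show "(\<Sum>i\<le>n. coeff (P c n) i * \<mu> c (i + m)) = 0"
        using monic_ops.L_P_lower_degree[OF ops] m by (simp add: moment_expansion degree_monom_eq)
    qed simp
    then have "L (Q * monom 1 m) + L (P c n * monom 1 (Suc m)) / c = 0"
      using DERIV_unique DERIV_const by blast
    then show ?thesis by simp
  qed
  have vanish: "L (Q * monom 1 m) = 0" if "Suc m < n" for m
    using that low[of m] by (simp add: L_P_lower_degree degree_monom_eq)
  have top: "L (Q * monom 1 (n - 1)) = - h c n / c" if "n > 0"
    using that low[of "n - 1"] L_P_mult[of "monom 1 n" n] by (simp add: degree_monom_eq)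
  have deg_Q: "degree Q < n" if "n > 0"
    using that by (intro degree_lessI) (auto simp: coeff_Q)
  show "((\<lambda>c. B_at c n) has_real_derivative r_at c n / c) (at c)"
  proof (cases n)
    case 0
    have "((\<lambda>c. 0) has_real_derivative r n / c) (at c)" by (simp add: 0 r_def)
    then show ?thesis
      by (rule has_field_derivative_transform_within_open[OF _ _ c])
        (auto simp: monic_ops.B_def[OF ops] 0)
  next
    case (Suc k)
    have "L (P c k * Q) = q' k * h c k"
      using deg_Q Suc by (subst L_P_mult) (auto simp: coeff_Q)
    moreover have "L (Q * P c k) = (\<Sum>i\<le>k. coeff (P c k) i * L (Q * monom 1 i))"
      by (rule L_mult_expand) simp
    moreover have "\<dots> = L (Q * monom 1 k)"
      using vanish Suc by (simp add: lessThan_Suc_atMost[symmetric] monic)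
    ultimately have "q' k * h c k = - h c n / c" using top Suc by (simp add: mult.commute)
    then have "- q' k = r n / c" using h_pos[of k] c by (simp add: r_def Suc field_simps)
    then have "((\<lambda>c. - coeff (P c n) k) has_real_derivative r n / c) (at c)"
      using DERIV_minus[OF q'[of k]] by simp
    then show ?thesis
      by (rule has_field_derivative_transform_within_open[OF _ _ c])
        (auto simp: monic_ops.B_def[OF ops] Suc)
  qed
  \<comment> \<open>Expanding \<open>L (Q * P c n) = 0\<close> in monomials, only the two top
    degrees survive.\<close>
  have "L (Q * monom 1 n) = - B n * h c n / c"
  proof (cases n)
    case 0
    then show ?thesis by (simp add: Q_def B_def)
  next
    case (Suc k)
    have "0 = L (Q * P c n)" using deg_Q Suc L_P_lower_degree[of Q n] by (simp add: mult.commute)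
    also have "\<dots> = (\<Sum>i\<le>n. coeff (P c n) i * L (Q * monom 1 i))"
      by (rule L_mult_expand) simp
    also have "\<dots> = L (Q * monom 1 n) + coeff (P c n) k * L (Q * monom 1 k)"
      using vanish Suc monic[of n] by (simp add: lessThan_Suc_atMost[symmetric])
    finally show ?thesis using top Suc by (simp add: B_def)
  qed
  moreover have "((\<lambda>c. h c n) has_real_derivative
      L (Q * monom 1 n) + L (P c n * monom 1 (Suc n)) / c) (at c)"
  proof (rule has_field_derivative_transform_within_open[OF F _ c])
    fix c assume "c \<in> I"
    then show "(\<Sum>i\<le>n. coeff (P c n) i * \<mu> c (i + n)) = h c n"
      using monic_ops.h_eq[OF ops, of c n] by simp
  qed simp
  ultimately show "((\<lambda>c. h c n) has_real_derivative b_at c n * h c n / c) (at c)"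
    by (simp add: L_P_monom_Suc b_eq_B algebra_simps diff_divide_distrib)
qed

section \<open>The sigma equation\<close>

abbreviation xi_at where "xi_at c \<equiv> hyp_ops.xi \<alpha> \<beta> \<gamma> c (P c) (h c)"

lemma r_deriv:
  assumes c: "c \<in> I" and n: "n > 0"
  shows "((\<lambda>c. r_at c n) has_real_derivative r_at c n * (b_at c n - b_at c (n - 1)) / c) (at c)"
proof -
  have h: "h c m \<noteq> 0" for m using monic_ops.h_pos[OF ops[OF c], of m] by simp
  have "((\<lambda>c. h c n / h c (n - 1)) has_real_derivative
    h c n / h c (n - 1) * (b_at c n - b_at c (n - 1)) / c) (at c)"
    by (rule DERIV_cong[OF DERIV_divide[OF Toda(2)[OF c] Toda(2)[OF c] h]])
      (use h c in \<open>simp add: field_simps\<close>)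
  moreover have "r_at c n = h c n / h c (n - 1)" if "c \<in> I" for c
    using monic_ops.r_def[OF ops[OF that]] n by simp
  ultimately show ?thesis
    using c by (auto intro: has_field_derivative_transform_within_open[of _ _ _ I])
qed

lemma sigma_PVI:
  assumes \<sigma>: "\<And>c. c \<in> I \<Longrightarrow>
      \<sigma> c = (c - 1) * (\<Sum>k<n. xi_at c k) + K_const \<alpha> \<beta> n * c + L_const \<alpha> \<beta> \<gamma> n"
    and cI: "c \<in> I"
  shows "sigma_PVI_at
      ((real n + \<alpha> - \<beta>) / 2) ((- real n + \<alpha> - \<beta>) / 2)
      ((real n + \<alpha> + \<beta> - 2) / 2) ((real n + \<alpha> + \<beta> - 2 * \<gamma>) / 2) \<sigma> c"
proof -
  define K l where "K = K_const \<alpha> \<beta> n" and "l = L_const \<alpha> \<beta> \<gamma> n"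
  define T1 T2 where "T1 = real n * \<gamma> - real n * (real n - 1) / 2"
    and "T2 = (\<alpha> + \<beta>) * real n + real n * (real n - 1) / 2"
  \<comment> \<open>The derivative of the expression in \<open>\<sigma>_eq\<close>, by the first
    Toda equation.\<close>
  define s where "s c = B_at c n - (1 - c) * (r_at c n / c) + T2 + K" for c
  have \<sigma>_eq: "\<sigma> c = - (1 - c) * B_at c n - T1 + c * T2 + K * c + l" if "c \<in> I" for c
    using hyp_ops.sum_xi[OF hyp[OF that], of n] \<sigma>[OF that]
    by (simp add: T1_def T2_def K_def l_def algebra_simps)
  have \<sigma>': "(\<sigma> has_real_derivative s c) (at c)" if c: "c \<in> I" for c
  proof -
    have "((\<lambda>c. - (1 - c) * B_at c n - T1 + c * T2 + K * c + l) has_real_derivative s c) (at c)"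
      using c by (auto intro!: derivative_eq_intros Toda(1) simp: s_def field_simps)
    then show ?thesis
      using c \<sigma>_eq by (auto intro: has_field_derivative_transform_within_open[of _ _ _ I])
  qed
  have deriv_\<sigma>: "deriv \<sigma> c = s c" if "c \<in> I" for c
    using \<sigma>'[OF that] by (rule DERIV_imp_deriv)
  have c01: "0 < c" "c < 1" using cI by auto
  obtain t where s': "(s has_real_derivative t) (at c)"
    and ids: "s c * (c * (c - 1) * t)\<^sup>2
       + (s c * (2 * \<sigma> c - (2 * c - 1) * s c) + (real n + \<alpha> - \<beta>) / 2 * ((- real n + \<alpha> - \<beta>) / 2)
         * ((real n + \<alpha> + \<beta> - 2) / 2) * ((real n + \<alpha> + \<beta> - 2 * \<gamma>) / 2))\<^sup>2
     = (s c + ((real n + \<alpha> - \<beta>) / 2)\<^sup>2) * (s c + ((- real n + \<alpha> - \<beta>) / 2)\<^sup>2)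
         * (s c + ((real n + \<alpha> + \<beta> - 2) / 2)\<^sup>2) * (s c + ((real n + \<alpha> + \<beta> - 2 * \<gamma>) / 2)\<^sup>2)"
  proof -
    interpret hyp_ops \<alpha> \<beta> \<gamma> c "P c" "h c" by (rule hyp[OF cI])
    define E F R where "E = e n 0" and "F = c * f n 0" and "R = ((1 - c) / c)\<^sup>2 * r n"
    define Y0 where "Y0 = - (\<alpha> * \<beta> - E) * (\<gamma> + F) + \<alpha> * \<beta> * \<gamma>"
    define Y1 where "Y1 = - (\<alpha> * \<beta> - E) * (\<gamma> + 1 - real n)
      - (\<alpha> + \<beta> + real n) * (\<gamma> + F) + \<alpha> * \<beta> * (\<gamma> + 1) + \<gamma> * (\<alpha> + \<beta>)"
    define Y2 where "Y2 = E - F + real n * (\<alpha> + \<beta> - \<gamma> - 1 + real n)"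
    have cR: "c * R = Y2"
    proof (cases "n = 0")
      case False
      then show ?thesis using det_coeffs(1)[of n] by (simp add: R_def E_def F_def Y2_def)
    qed (simp add: R_def E_def F_def Y2_def)
    have cr: "(1 - c) * ((1 - c) * (r n / c)) = c * R"
      using c01 by (simp add: R_def power2_eq_square)
    have cEF: "c * E - F = (1 - c) * B n + T1 - c * T2"
      using e_diff_f[of n] sum_xi[of n] by (simp add: E_def F_def T1_def T2_def algebra_simps)
    \<comment> \<open>Here \<open>(1 - c) * B n\<close> is taken from \<open>cEF\<close> and the
      term with \<open>r n\<close> from \<open>cR\<close>. Then \<open>F\<close> cancels, and
      \<open>T2 - T1\<close> equals
      \<open>n * (\<alpha> + \<beta> - \<gamma> - 1 + n)\<close>.\<close>
    have sE: "E = K - s c"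
    proof -
      have "(1 - c) * s c = (1 - c) * B n - (1 - c) * ((1 - c) * (r n / c)) + (1 - c) * (T2 + K)"
        by (simp add: s_def algebra_simps)
      also have "\<dots> = (1 - c) * (K - E)"
        unfolding cr cR Y2_def using cEF by (simp add: T1_def T2_def field_simps)
      finally have "s c = K - E" using c01 by simp
      then show ?thesis by simp
    qed
    have \<sigma>F: "\<sigma> c - c * s c = F + l"
      using \<sigma>_eq[OF cI] cEF sE by (simp add: algebra_simps)
    \<comment> \<open>For \<open>n = 0\<close> there is no preceding index: \<open>s\<close> is the
      constant \<open>K\<close> and both sides are 0. Otherwise \<open>c * (c - 1) * t\<close> is
      \<open>c * R\<close> times the difference of consecutive \<open>xi\<close>.\<close>
    have s1: "\<exists>t. (s has_real_derivative t) (at c) \<and> (c * (c - 1) * t)\<^sup>2 = Y1\<^sup>2 - 4 * Y2 * Y0"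
    proof (cases "n = 0")
      case True
      have "s c = K" if "c \<in> I" for c
        using monic_ops.B_def[OF ops[OF that]] monic_ops.r_def[OF ops[OF that]]
        by (simp add: s_def True T2_def)
      then have "(s has_real_derivative 0) (at c)"
        by (intro has_field_derivative_transform_within_open[OF DERIV_const[of K] _ cI]) auto
      moreover have "Y1\<^sup>2 - 4 * Y2 * Y0 = 0"
        by (simp add: Y0_def Y1_def Y2_def E_def F_def True algebra_simps)
      ultimately show ?thesis by auto
    next
      case False
      then have n: "n > 0" by simp
      let ?t = "r n / c - (- 1 * (r n / c) + (1 - c) * ((r n * (b n - b (n - 1)) / c * c - r n) / (c * c)))"
      define q where "q c = r_at c n / c" for c
      have q': "(q has_real_derivative (r n * (b n - b (n - 1)) / c * c - r n) / (c * c)) (at c)"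
        unfolding q_def using DERIV_divide[OF r_deriv[OF cI n] DERIV_ident] c01 by simp
      have s_eq: "s = (\<lambda>c. B_at c n - (1 - c) * q c + T2 + K)"
        by (simp add: s_def q_def fun_eq_iff)
      have qc: "q c = r n / c" by (simp add: q_def)
      have "(s has_real_derivative ?t) (at c)"
        unfolding s_eq using c01
        by (auto intro!: derivative_eq_intros Toda(1)[OF cI] q' simp: qc)
      moreover have "c * (c - 1) * ?t = c * R * (xi n - xi (n - 1))"
      proof -
        have x: "(1 - c) * (xi n - xi (n - 1)) = (1 - c) * (b n - b (n - 1)) - 1 - c"
          using xi_eq[of n] xi_eq[of "n - 1"] n by (simp add: of_nat_diff algebra_simps)
        have "c * (c - 1) * ?t = (1 - c) * (r n / c) * ((1 - c) * (b n - b (n - 1)) - 1 - c)"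
          using c01 by (simp add: field_simps)
        also have "\<dots> = (1 - c) * (r n / c) * ((1 - c) * (xi n - xi (n - 1)))"
          unfolding x ..
        finally show ?thesis unfolding cr[symmetric] by (simp only: mult_ac)
      qed
      moreover have "(c * R * (xi n - xi (n - 1)))\<^sup>2 = Y1\<^sup>2 - 4 * Y2 * Y0"
      proof -
        \<comment> \<open>The squared difference of the roots of a quadratic, scaled by its leading
          coefficient, is the discriminant.\<close>
        have "(c * R * (xi n - xi (n - 1)))\<^sup>2 = (c * R * (xi n + xi (n - 1)))\<^sup>2
          - 4 * (c * R) * (c * R * (xi n * xi (n - 1)))"
          by algebra
        then show ?thesis
          using det_coeffs[OF n] by (simp only: R_def E_def F_def Y0_def Y1_def Y2_def)
      qed
      ultimately show ?thesis by metis
    qed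
    then obtain t where t: "(s has_real_derivative t) (at c)"
      "(c * (c - 1) * t)\<^sup>2 = Y1\<^sup>2 - 4 * Y2 * Y0" by blast
    have "2 * \<sigma> c - (2 * c - 1) * s c = 2 * (F + l) + s c"
      using \<sigma>F by (simp add: algebra_simps)
    then show ?thesis
      using that[OF t(1)] unfolding t(2)
      by (simp only: sigma_identity[OF sE[unfolded K_def K_const_def] refl l_def[unfolded L_const_def]
          Y2_def Y1_def Y0_def refl refl refl refl])
  qed
  have d2: "(deriv \<sigma> has_real_derivative t) (at c)"
    by (rule has_field_derivative_transform_within_open[OF s' _ cI]) (simp_all add: deriv_\<sigma>)
  show ?thesis
    unfolding sigma_PVI_at_def deriv_\<sigma>[OF cI] DERIV_imp_deriv[OF d2]
    using \<sigma>'[OF cI] d2 ids real_differentiable_def by blast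
qed

end

theorem theorem5p1:
  fixes \<alpha> \<beta> \<gamma> :: real and n :: nat and p :: "real \<Rightarrow> nat \<Rightarrow> real poly"
  assumes "\<alpha> > 0" and "\<beta> > 0" and "\<gamma> > 0"
    and "\<And>c. 0 < c \<Longrightarrow> c < 1 \<Longrightarrow> orthonormal_polys (hyp_weight \<alpha> \<beta> \<gamma> c) (p c)"
  shows "\<forall>c\<in>{0<..<1}.
    sigma_PVI_at
      ((real n + \<alpha> - \<beta>) / 2)
      ((- real n + \<alpha> - \<beta>) / 2)
      ((real n + \<alpha> + \<beta> - 2) / 2)
      ((real n + \<alpha> + \<beta> - 2 * \<gamma>) / 2)
      (sigma_fun \<alpha> \<beta> \<gamma> p n) c"
proof -
  define P where "P c k = smult (1 / lead_coeff (p c k)) (p c k)" for c k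
  define h where "h c k = 1 / (lead_coeff (p c k))\<^sup>2" for c k
  have hyp: "hyp_ops \<alpha> \<beta> \<gamma> c (P c) (h c)" if "c \<in> {0<..<1}" for c
    using monic_ops_of_orthonormal[of "hyp_weight \<alpha> \<beta> \<gamma> c" "p c"] assms that
    by (simp add: hyp_ops_def hyp_ops_axioms_def P_def[abs_def] h_def[abs_def])
  interpret hyp_family \<alpha> \<beta> \<gamma> P h by (rule hyp_family.intro) (rule hyp)
  have "x_coeff \<alpha> \<beta> \<gamma> c (p c) k = xi_at c k" if "c \<in> {0<..<1}" for c k
  proof (rule hyp_ops.x_coeff_eq[OF hyp[OF that]])
    have "lead_coeff (p c k) > 0"
      using assms(4)[of c] that unfolding orthonormal_polys_def greaterThanLessThan_iff by blast
    then have "lead_coeff (p c k) \<noteq> 0" by linarith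
    then show "p c k = smult (lead_coeff (p c k)) (P c k)" "(lead_coeff (p c k))\<^sup>2 * h c k = 1"
      by (simp_all add: P_def h_def)
  qed
  then show ?thesis
    by (intro ballI sigma_PVI) (auto simp: sigma_fun_def S_sum_def)
qed

end
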